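(* Let $\mathscr{A}\subset\mathscr{X}$ be a conic acceptance set and $S=(S_0,S_T)$ a traded asset. The following statements hold: (i) $\rho_{\mathscr{A},S}(X)<\infty$ for all $X\in\mathscr{X}$ if and only if $S_T\in\operatorname{int}(\mathscr{A})$; (ii) $\rho_{\mathscr{A},S}(X)>-\infty$ for all $X\in\mathscr{X}$ if and only if $-S_T\notin\overline{\mathscr{A}}$.
   Context: Let $(\Omega,\mathcal{F})$ be a measurable space and $\mathscr{X}$ the Banach space of bounded $\mathcal{F}$-measurable functions $X:\Omega\to\mathbb{R}$ with the supremum norm $\|X\|=\sup_{\omega\in\Omega}|X(\omega)|$, ordered pointwise ($Y\ge X$ means $Y(\omega)\ge X(\omega)$ for all $\omega$); $\mathscr{X}_+=\{X\in\mathscr{X}: X\ge 0\}$. Functions are not identified almost surely. Interior $\operatorname{int}$ and closure $\overline{\,\cdot\,}$ are with respect to the norm. An acceptance set is a nonempty proper subset $\mathscr{A}\subset\mathscr{X}$ such that $X\in\mathscr{A}$ and $Y\ge X$ imply $Y\in\mathscr{A}$. It is conic if it is a cone, i.e. $\lambda X\in\mathscr{A}$ for all $X\in\mathscr{A}$ and $\lambda>0$. A traded asset is a pair $S=(S_0,S_T)$ with $S_0\in\mathbb{R}$, $S_0>0$, and $S_T\in\mathscr{X}_+$, $S_T\ne 0$. The risk measure is $\rho_{\mathscr{A},S}:\mathscr{X}\to\mathbb{R}\cup\{-\infty,\infty\}$, $\rho_{\mathscr{A},S}(X)=\inf\{m\in\mathbb{R}: X+\frac{m}{S_0}S_T\in\mathscr{A}\}$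 (with $\inf\emptyset=\infty$). *)

theory Defs
  imports "HOL-Analysis.Analysis"
begin

text \<open>
  The measurable space is given by \<open>space M\<close> and \<open>sets M\<close>; the measure carried by \<open>M\<close> plays no role.
  A function on \<open>space M\<close> is represented by its extension by \<open>0\<close> to the whole type, so that
  functions on \<open>space M\<close> are represented uniquely and the pointwise vector space operations stay
  inside the carrier.
\<close>

definition bmfun :: "'a measure \<Rightarrow> ('a \<Rightarrow> real) set" where
  "bmfun M = {X \<in> borel_measurable M. bounded (X ` space M) \<and> (\<forall>\<omega>. \<omega> \<notin> space M \<longrightarrow> X \<omega> = 0)}"

definition bmfun_nonneg :: "'a measure \<Rightarrow> ('a \<Rightarrow> real) set" where
  "bmfun_nonneg M = {X \<in> bmfun M. \<forall>\<omega>\<in>space M. 0 \<le> X \<omega>}"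

definition sup_norm :: "'a measure \<Rightarrow> ('a \<Rightarrow> real) \<Rightarrow> real" where
  "sup_norm M X = (SUP \<omega>\<in>space M. \<bar>X \<omega>\<bar>)"

text \<open>
  The locale \<open>Metric_space\<close> asks for nonnegativity and symmetry of the distance also off the
  carrier, where the supremum may be an unspecified real; hence the value \<open>0\<close> there.
\<close>

definition sup_dist :: "'a measure \<Rightarrow> ('a \<Rightarrow> real) \<Rightarrow> ('a \<Rightarrow> real) \<Rightarrow> real" where
  "sup_dist M X Y =
     (if X \<in> bmfun M \<and> Y \<in> bmfun M then sup_norm M (\<lambda>\<omega>. X \<omega> - Y \<omega>) else 0)"

definition norm_topology :: "'a measure \<Rightarrow> ('a \<Rightarrow> real) topology" where
  "norm_topology M = Metric_space.mtopology (bmfun M) (sup_dist M)"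

definition acceptance_set :: "'a measure \<Rightarrow> ('a \<Rightarrow> real) set \<Rightarrow> bool" where
  "acceptance_set M A \<longleftrightarrow> A \<noteq> {} \<and> A \<subset> bmfun M \<and>
     (\<forall>X\<in>A. \<forall>Y\<in>bmfun M. (\<forall>\<omega>\<in>space M. X \<omega> \<le> Y \<omega>) \<longrightarrow> Y \<in> A)"

definition is_cone :: "('a \<Rightarrow> real) set \<Rightarrow> bool" where
  "is_cone A \<longleftrightarrow> (\<forall>X\<in>A. \<forall>c>0. (\<lambda>\<omega>. c * X \<omega>) \<in> A)"

definition traded_asset :: "'a measure \<Rightarrow> real \<times> ('a \<Rightarrow> real) \<Rightarrow> bool" where
  "traded_asset M S \<longleftrightarrow> fst S > 0 \<and> snd S \<in> bmfun_nonneg M \<and> snd S \<noteq> (\<lambda>\<omega>. 0)"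

definition risk_measure ::
    "('a \<Rightarrow> real) set \<Rightarrow> real \<times> ('a \<Rightarrow> real) \<Rightarrow> ('a \<Rightarrow> real) \<Rightarrow> ereal" where
  "risk_measure A S X = Inf (ereal ` {m. (\<lambda>\<omega>. X \<omega> + m / fst S * snd S \<omega>) \<in> A})"

text \<open>
  The constant \<open>Metric_space.mtopology\<close> is only meaningful for a metric. This holds as soon as
  \<open>space M\<close> is nonempty, which the existence of a traded asset guarantees.
\<close>

lemma bmfun_diff: "X \<in> bmfun M \<Longrightarrow> Y \<in> bmfun M \<Longrightarrow> (\<lambda>\<omega>. X \<omega> - Y \<omega>) \<in> bmfun M"
  by (auto simp: bmfun_def intro: bounded_minus_comp)

lemma bmfun_abs_le_sup_norm:
  assumes "X \<in> bmfun M" "\<omega> \<in> space M"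
  shows "\<bar>X \<omega>\<bar> \<le> sup_norm M X"
proof -
  from assms(1) obtain B where "\<And>\<omega>. \<omega> \<in> space M \<Longrightarrow> \<bar>X \<omega>\<bar> \<le> B"
    by (auto simp: bmfun_def bounded_iff)
  then have "bdd_above ((\<lambda>\<omega>. \<bar>X \<omega>\<bar>) ` space M)"
    by (rule bdd_aboveI2)
  then show ?thesis
    unfolding sup_norm_def using assms(2) by (rule cSUP_upper2) simp
qed

lemma Metric_space_bmfun:
  assumes ne: "space M \<noteq> {}"
  shows "Metric_space (bmfun M) (sup_dist M)"
proof
  obtain w where w: "w \<in> space M" using ne by blast
  show "0 \<le> sup_dist M X Y" for X Y
    using bmfun_abs_le_sup_norm[OF bmfun_diff w, of X Y]
    by (auto simp: sup_dist_def intro: order_trans[OF abs_ge_zero])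
  show "sup_dist M X Y = sup_dist M Y X" for X Y
    by (simp add: sup_dist_def sup_norm_def abs_minus_commute)
  show "sup_dist M X Y = 0 \<longleftrightarrow> X = Y" if X: "X \<in> bmfun M" and Y: "Y \<in> bmfun M" for X Y
  proof
    assume "sup_dist M X Y = 0"
    then have "X \<omega> = Y \<omega>" if "\<omega> \<in> space M" for \<omega>
      using bmfun_abs_le_sup_norm[OF bmfun_diff[OF X Y] that] X Y by (simp add: sup_dist_def)
    moreover have "X \<omega> = Y \<omega>" if "\<omega> \<notin> space M" for \<omega>
      using X Y that by (simp add: bmfun_def)
    ultimately show "X = Y" by blast
  next
    assume "X = Y"
    then show "sup_dist M X Y = 0" using ne X by (simp add: sup_dist_def sup_norm_def)
  qed
  show "sup_dist M X Z \<le> sup_dist M X Y + sup_dist M Y Z"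
    if X: "X \<in> bmfun M" and Y: "Y \<in> bmfun M" and Z: "Z \<in> bmfun M" for X Y Z
  proof -
    have "\<bar>X \<omega> - Z \<omega>\<bar> \<le> sup_dist M X Y + sup_dist M Y Z" if "\<omega> \<in> space M" for \<omega>
      using bmfun_abs_le_sup_norm[OF bmfun_diff[OF X Y] that]
        bmfun_abs_le_sup_norm[OF bmfun_diff[OF Y Z] that] X Y Z
      by (simp add: sup_dist_def)
    then have "sup_norm M (\<lambda>\<omega>. X \<omega> - Z \<omega>) \<le> sup_dist M X Y + sup_dist M Y Z"
      unfolding sup_norm_def using ne by (intro cSUP_least) auto
    then show ?thesis using X Z by (simp add: sup_dist_def)
  qed
qed

end

theory Submission
  imports Defs
begin

text \<open>
  Monotonicity reduces both topological conditions to constant shifts: \<open>X\<close> is interior to \<open>A\<close> iff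
  \<open>X - e \<in> A\<close> for some \<open>e > 0\<close>, and \<open>X\<close> is in the closure iff \<open>X + e \<in> A\<close> for all \<open>e > 0\<close>. Since
  \<open>S\<^sub>T \<ge> 0\<close>, the risk of \<open>X\<close> is below \<open>\<infinity>\<close> iff \<open>X + c S\<^sub>T \<in> A\<close> for some \<open>c > 0\<close>, and equals
  \<open>-\<infinity>\<close> iff \<open>X - c S\<^sub>T \<in> A\<close> for all \<open>c > 0\<close>. Rescaling within the cone and comparing a bounded
  \<open>X\<close> with constants turns one kind of condition into the other.
\<close>

lemma bmfun_linear:
  assumes "X \<in> bmfun M" "Y \<in> bmfun M"
  shows "(\<lambda>\<omega>. X \<omega> + c * Y \<omega>) \<in> bmfun M"
proof -
  have "bounded ((\<lambda>\<omega>. c * Y \<omega>) ` space M)"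
    using bounded_scaling[of "Y ` space M" c] assms by (simp add: bmfun_def image_image)
  then show ?thesis using assms by (auto simp: bmfun_def intro: bounded_plus_comp)
qed

text \<open>Stands in for the constant function 1: members of \<open>bmfun M\<close> must vanish off
  \<open>space M\<close>, so shifts by constants are taken along this indicator.\<close>

lemma indicator_space_bmfun: "indicator (space M) \<in> bmfun M"
  by (auto simp: bmfun_def bounded_iff intro!: exI[of _ 1])

text \<open>The bound is chosen strictly positive because it later enters cone scaling factors, also
  as a divisor.\<close>

lemma bmfun_bound:
  assumes "X \<in> bmfun M"
  obtains B where "B > 0" "\<And>\<omega>. \<omega> \<in> space M \<Longrightarrow> \<bar>X \<omega>\<bar> \<le> B"
  using assms by (auto simp: bmfun_def bounded_pos)

lemma acceptance_setD:
  assumes "acceptance_set M A" "X \<in> A" "Y \<in> bmfun M" "\<And>\<omega>. \<omega> \<in> space M \<Longrightarrow> X \<omega> \<le> Y \<omega>"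
  shows "Y \<in> A"
  using assms unfolding acceptance_set_def by blast

lemma sup_dist_shift:
  assumes "space M \<noteq> {}" "X \<in> bmfun M"
  shows "sup_dist M X (\<lambda>\<omega>. X \<omega> + c * indicator (space M) \<omega>) = \<bar>c\<bar>"
  using assms bmfun_linear[OF assms(2) indicator_space_bmfun]
  by (simp add: sup_dist_def sup_norm_def)

lemma sup_dist_bound:
  assumes "X \<in> bmfun M" "Y \<in> bmfun M" "\<omega> \<in> space M"
  shows "\<bar>X \<omega> - Y \<omega>\<bar> \<le> sup_dist M X Y"
  using bmfun_abs_le_sup_norm[OF bmfun_diff[OF assms(1,2)] assms(3)] assms
  by (simp add: sup_dist_def)

text \<open>A ball around \<open>X\<close> contains a small downward shift of \<open>X\<close>.
  Conversely, every point within distance \<open>e\<close> of \<open>X\<close> dominates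
  \<open>X - e\<close>, so monotonicity puts the whole ball into \<open>A\<close>.\<close>

lemma interior_of_acceptance_set:
  assumes ne: "space M \<noteq> {}" and A: "acceptance_set M A" and X: "X \<in> bmfun M"
  shows "X \<in> norm_topology M interior_of A \<longleftrightarrow>
    (\<exists>e>0. (\<lambda>\<omega>. X \<omega> - e * indicator (space M) \<omega>) \<in> A)"
proof -
  interpret Metric_space "bmfun M" "sup_dist M" using ne by (rule Metric_space_bmfun)
  have ball: "X \<in> norm_topology M interior_of A \<longleftrightarrow> (\<exists>r>0. mball X r \<subseteq> A)"
    using X by (simp add: norm_topology_def in_interior_of_mball)
  show ?thesis
    unfolding ball
  proof (intro iffI; elim exE conjE)
    fix r :: real assume r: "r > 0" "mball X r \<subseteq> A"
    \<comment> \<open>Balls are open and the shift by \<open>r\<close> has distance exactly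
      \<open>r\<close>, hence the half radius.\<close>
    have "(\<lambda>\<omega>. X \<omega> + (- (r / 2)) * indicator (space M) \<omega>) \<in> mball X r"
      using r(1) X sup_dist_shift[OF ne X, of "- (r / 2)"]
        bmfun_linear[OF X indicator_space_bmfun, of "- (r / 2)"] by simp
    then show "\<exists>e>0. (\<lambda>\<omega>. X \<omega> - e * indicator (space M) \<omega>) \<in> A"
      using r by (intro exI[of _ "r / 2"]) auto
  next
    fix e :: real assume e: "e > 0" "(\<lambda>\<omega>. X \<omega> - e * indicator (space M) \<omega>) \<in> A"
    have "Y \<in> A" if "Y \<in> mball X e" for Y
    proof (rule acceptance_setD[OF A e(2)])
      show Y: "Y \<in> bmfun M" using that by simp
      show "X \<omega> - e * indicator (space M) \<omega> \<le> Y \<omega>" if "\<omega> \<in> space M" for \<omega>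
        using sup_dist_bound[OF X Y that] \<open>Y \<in> mball X e\<close> that by (simp add: abs_le_iff)
    qed
    then show "\<exists>r>0. mball X r \<subseteq> A" using e(1) by blast
  qed
qed

text \<open>A point of \<open>A\<close> within distance \<open>e\<close> of \<open>X\<close> lies
  below \<open>X + e\<close>, which is then accepted by monotonicity. Conversely, the upward shifts
  of \<open>X\<close> are themselves points of \<open>A\<close> approaching
  \<open>X\<close>.\<close>

lemma closure_of_acceptance_set:
  assumes ne: "space M \<noteq> {}" and A: "acceptance_set M A" and X: "X \<in> bmfun M"
  shows "X \<in> norm_topology M closure_of A \<longleftrightarrow>
    (\<forall>e>0. (\<lambda>\<omega>. X \<omega> + e * indicator (space M) \<omega>) \<in> A)"
proof -
  interpret Metric_space "bmfun M" "sup_dist M" using ne by (rule Metric_space_bmfun)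
  have ball: "X \<in> norm_topology M closure_of A \<longleftrightarrow> (\<forall>r>0. \<exists>Y\<in>A. Y \<in> mball X r)"
    using X by (simp add: norm_topology_def metric_closure_of)
  show ?thesis
    unfolding ball
  proof (intro iffI allI impI)
    fix e :: real assume "\<forall>r>0. \<exists>Y\<in>A. Y \<in> mball X r" "e > 0"
    then obtain Y where Y: "Y \<in> A" "Y \<in> mball X e" by blast
    show "(\<lambda>\<omega>. X \<omega> + e * indicator (space M) \<omega>) \<in> A"
    proof (rule acceptance_setD[OF A Y(1) bmfun_linear[OF X indicator_space_bmfun]])
      show "Y \<omega> \<le> X \<omega> + e * indicator (space M) \<omega>" if "\<omega> \<in> space M" for \<omega>
        using sup_dist_bound[OF X _ that, of Y] Y(2) that by (simp add: abs_le_iff)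
    qed
  next
    fix r :: real assume *: "\<forall>e>0. (\<lambda>\<omega>. X \<omega> + e * indicator (space M) \<omega>) \<in> A" and r: "r > 0"
    have "(\<lambda>\<omega>. X \<omega> + r / 2 * indicator (space M) \<omega>) \<in> A" using r by (intro *[rule_format]) simp
    moreover have "(\<lambda>\<omega>. X \<omega> + r / 2 * indicator (space M) \<omega>) \<in> mball X r"
      using r X sup_dist_shift[OF ne X, of "r / 2"]
        bmfun_linear[OF X indicator_space_bmfun, of "r / 2"] by simp
    ultimately show "\<exists>Y\<in>A. Y \<in> mball X r" by blast
  qed
qed

text \<open>The payoff is nonzero yet vanishes off \<open>space M\<close>.\<close>

lemma traded_asset_space_nonempty:
  assumes "traded_asset M S"
  shows "space M \<noteq> {}"
  using assms by (auto simp: traded_asset_def bmfun_nonneg_def bmfun_def)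

text \<open>Nonnegativity of the payoff makes the set of accepted multiples upward closed, whatever
  the signs of \<open>c\<close> and \<open>d\<close>.\<close>

lemma acceptance_set_asset_mono:
  assumes A: "acceptance_set M A" and S: "traded_asset M S" and X: "X \<in> bmfun M"
    and "(\<lambda>\<omega>. X \<omega> + c * snd S \<omega>) \<in> A" "c \<le> d"
  shows "(\<lambda>\<omega>. X \<omega> + d * snd S \<omega>) \<in> A"
proof (rule acceptance_setD[OF A assms(4)])
  show "(\<lambda>\<omega>. X \<omega> + d * snd S \<omega>) \<in> bmfun M"
    using S by (intro bmfun_linear X) (simp add: traded_asset_def bmfun_nonneg_def)
  show "X \<omega> + c * snd S \<omega> \<le> X \<omega> + d * snd S \<omega>" if "\<omega> \<in> space M" for \<omega>
    using S that assms(5) by (auto simp: traded_asset_def bmfun_nonneg_def intro: mult_right_mono)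
qed

text \<open>An infimum is below \<infinity> iff its set contains a real number. Dividing by the
  price only rescales that number, and upward closedness allows a positive multiple, as cone scaling
  requires.\<close>

lemma risk_measure_less_PInf_iff:
  assumes A: "acceptance_set M A" and S: "traded_asset M S" and X: "X \<in> bmfun M"
  shows "risk_measure A S X < \<infinity> \<longleftrightarrow> (\<exists>c>0. (\<lambda>\<omega>. X \<omega> + c * snd S \<omega>) \<in> A)"
proof -
  have S0: "fst S > 0" using S by (simp add: traded_asset_def)
  have "risk_measure A S X < \<infinity> \<longleftrightarrow> (\<exists>m. (\<lambda>\<omega>. X \<omega> + m / fst S * snd S \<omega>) \<in> A)"
    by (simp add: risk_measure_def Inf_less_iff del: ereal_infty_less)
  also have "\<dots> \<longleftrightarrow> (\<exists>c>0. (\<lambda>\<omega>. X \<omega> + c * snd S \<omega>) \<in> A)"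
  proof (intro iffI; elim exE conjE)
    fix m assume "(\<lambda>\<omega>. X \<omega> + m / fst S * snd S \<omega>) \<in> A"
    then have "(\<lambda>\<omega>. X \<omega> + max 1 (m / fst S) * snd S \<omega>) \<in> A"
      by (rule acceptance_set_asset_mono[OF A S X]) simp
    then show "\<exists>c>0. (\<lambda>\<omega>. X \<omega> + c * snd S \<omega>) \<in> A"
      by (intro exI[of _ "max 1 (m / fst S)"]) simp
  next
    fix c :: real assume "(\<lambda>\<omega>. X \<omega> + c * snd S \<omega>) \<in> A"
    then show "\<exists>m. (\<lambda>\<omega>. X \<omega> + m / fst S * snd S \<omega>) \<in> A"
      using S0 by (intro exI[of _ "c * fst S"]) simp
  qed
  finally show ?thesis .
qed

text \<open>The infimum is -\<infinity> iff the accepted amounts are unbounded below. Being upward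
  closed, they then exhaust the reals.\<close>

lemma risk_measure_eq_MInf_iff:
  assumes A: "acceptance_set M A" and S: "traded_asset M S" and X: "X \<in> bmfun M"
  shows "risk_measure A S X = -\<infinity> \<longleftrightarrow> (\<forall>c>0. (\<lambda>\<omega>. X \<omega> - c * snd S \<omega>) \<in> A)"
proof -
  have S0: "fst S > 0" using S by (simp add: traded_asset_def)
  have "risk_measure A S X = -\<infinity> \<longleftrightarrow> (\<forall>r. risk_measure A S X < ereal r)"
    by (metis MInfty_neq_ereal(1) ereal_bot ereal_infty_less(2) less_imp_le less_ereal.simps(5))
  also have "\<dots> \<longleftrightarrow> (\<forall>r. \<exists>m<r. (\<lambda>\<omega>. X \<omega> + m / fst S * snd S \<omega>) \<in> A)"
    by (auto simp: risk_measure_def Inf_less_iff)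
  also have "\<dots> \<longleftrightarrow> (\<forall>c>0. (\<lambda>\<omega>. X \<omega> - c * snd S \<omega>) \<in> A)"
  proof (intro iffI allI impI)
    fix c :: real assume "\<forall>r. \<exists>m<r. (\<lambda>\<omega>. X \<omega> + m / fst S * snd S \<omega>) \<in> A"
    then obtain m where m: "m < - c * fst S" "(\<lambda>\<omega>. X \<omega> + m / fst S * snd S \<omega>) \<in> A" by blast
    have "(\<lambda>\<omega>. X \<omega> + (- c) * snd S \<omega>) \<in> A"
      using m(1) S0 by (intro acceptance_set_asset_mono[OF A S X m(2)]) (simp add: pos_divide_le_eq)
    then show "(\<lambda>\<omega>. X \<omega> - c * snd S \<omega>) \<in> A" by simp
  next
    fix r :: real assume *: "\<forall>c>0. (\<lambda>\<omega>. X \<omega> - c * snd S \<omega>) \<in> A"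
    \<comment> \<open>Besides lying below \<open>r\<close>, the amount must be negative, since the
      hypothesis covers only positive \<open>c\<close>.\<close>
    define m where "m = min (r - 1) (-1)"
    have "- (m / fst S) > 0" using S0 by (simp add: m_def divide_neg_pos)
    then have "(\<lambda>\<omega>. X \<omega> + m / fst S * snd S \<omega>) \<in> A" using *[rule_format, of "- (m / fst S)"] by simp
    then show "\<exists>m<r. (\<lambda>\<omega>. X \<omega> + m / fst S * snd S \<omega>) \<in> A"
      by (intro exI[of _ m]) (simp add: m_def)
  qed
  finally show ?thesis .
qed

theorem theorem3p3:
  fixes M :: "'a measure" and A :: "('a \<Rightarrow> real) set" and S :: "real \<times> ('a \<Rightarrow> real)"
  assumes "acceptance_set M A" and "is_cone A" and "traded_asset M S"
  shows "((\<forall>X\<in>bmfun M. risk_measure A S X < \<infinity>) \<longleftrightarrow> snd S \<in> norm_topology M interior_of A) \<and>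
         ((\<forall>X\<in>bmfun M. risk_measure A S X > -\<infinity>) \<longleftrightarrow>
            (\<lambda>\<omega>. - snd S \<omega>) \<notin> norm_topology M closure_of A)"
proof -
  note A = assms(1) and S = assms(3)
  let ?I = "indicator (space M) :: 'a \<Rightarrow> real"
  note I = indicator_space_bmfun[of M]
  have ne: "space M \<noteq> {}" using S by (rule traded_asset_space_nonempty)
  have T: "snd S \<in> bmfun M" using S by (simp add: traded_asset_def bmfun_nonneg_def)
  have zero: "(\<lambda>\<omega>. 0) \<in> bmfun M" by (auto simp: bmfun_def bounded_iff)
  have cone: "(\<lambda>\<omega>. c * X \<omega>) \<in> A" if "c > 0" "X \<in> A" for c X
    using assms(2) that by (auto simp: is_cone_def)
  have nI: "(\<lambda>\<omega>. - ?I \<omega>) \<in> bmfun M" using bmfun_linear[OF zero I, of "-1"] by simp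
  have nT: "(\<lambda>\<omega>. - snd S \<omega>) \<in> bmfun M" using bmfun_linear[OF zero T, of "-1"] by simp
  have "(\<forall>X\<in>bmfun M. \<exists>c>0. (\<lambda>\<omega>. X \<omega> + c * snd S \<omega>) \<in> A) \<longleftrightarrow>
    (\<exists>e>0. (\<lambda>\<omega>. snd S \<omega> - e * ?I \<omega>) \<in> A)"
  proof (intro iffI ballI)
    assume "\<forall>X\<in>bmfun M. \<exists>c>0. (\<lambda>\<omega>. X \<omega> + c * snd S \<omega>) \<in> A"
    \<comment> \<open>Testing the constant -1 suffices: dividing \<open>-1 + c * snd S\<close> by
      \<open>c\<close> leaves the payoff shifted down by \<open>1 / c\<close>.\<close>
    from bspec[OF this nI] obtain c where c: "c > 0" "(\<lambda>\<omega>. - ?I \<omega> + c * snd S \<omega>) \<in> A" by blast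
    have "(\<lambda>\<omega>. snd S \<omega> - 1 / c * ?I \<omega>) \<in> A"
      using cone[OF _ c(2), of "1 / c"] c(1) by (simp add: algebra_simps)
    then show "\<exists>e>0. (\<lambda>\<omega>. snd S \<omega> - e * ?I \<omega>) \<in> A" using c(1) by (intro exI[of _ "1 / c"]) simp
  next
    fix X assume X: "X \<in> bmfun M"
    assume "\<exists>e>0. (\<lambda>\<omega>. snd S \<omega> - e * ?I \<omega>) \<in> A"
    then obtain e where e: "e > 0" "(\<lambda>\<omega>. snd S \<omega> - e * ?I \<omega>) \<in> A" by blast
    obtain B where B: "B > 0" "\<And>\<omega>. \<omega> \<in> space M \<Longrightarrow> \<bar>X \<omega>\<bar> \<le> B" using X by (rule bmfun_bound) blast
    \<comment> \<open>The factor \<open>B / e\<close> turns the shift \<open>e\<close> into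
      \<open>B\<close>, and \<open>-B\<close> lies below \<open>X\<close>.\<close>
    have "(\<lambda>\<omega>. B / e * (snd S \<omega> - e * ?I \<omega>)) \<in> A" using B(1) e by (intro cone) simp_all
    then have "(\<lambda>\<omega>. X \<omega> + B / e * snd S \<omega>) \<in> A"
    proof (rule acceptance_setD[OF A _ bmfun_linear[OF X T]])
      show "B / e * (snd S \<omega> - e * ?I \<omega>) \<le> X \<omega> + B / e * snd S \<omega>" if "\<omega> \<in> space M" for \<omega>
        using B(2)[OF that] that e(1) by (simp add: right_diff_distrib)
    qed
    then show "\<exists>c>0. (\<lambda>\<omega>. X \<omega> + c * snd S \<omega>) \<in> A"
      using B(1) e(1) by (intro exI[of _ "B / e"]) simp
  qed
  then have i: "(\<forall>X\<in>bmfun M. risk_measure A S X < \<infinity>) \<longleftrightarrow> snd S \<in> norm_topology M interior_of A"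
    using risk_measure_less_PInf_iff[OF A S] by (simp add: interior_of_acceptance_set[OF ne A T])
  \<comment> \<open>Statement (ii) is proved in negated form: some position has risk -\<infinity>
    iff the negated payoff is in the closure.\<close>
  have "(\<exists>X\<in>bmfun M. \<forall>c>0. (\<lambda>\<omega>. X \<omega> - c * snd S \<omega>) \<in> A) \<longleftrightarrow>
    (\<forall>e>0. (\<lambda>\<omega>. - snd S \<omega> + e * ?I \<omega>) \<in> A)"
  proof (intro iffI allI impI; (elim bexE)?)
    fix X and e :: real
    assume X: "X \<in> bmfun M" and *: "\<forall>c>0. (\<lambda>\<omega>. X \<omega> - c * snd S \<omega>) \<in> A" and e: "e > 0"
    obtain B where B: "B > 0" "\<And>\<omega>. \<omega> \<in> space M \<Longrightarrow> \<bar>X \<omega>\<bar> \<le> B" using X by (rule bmfun_bound) blast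
    \<comment> \<open>With \<open>c = B / e\<close>, scaling by \<open>e / B\<close> restores the
      coefficient -1 of the payoff and shrinks \<open>X\<close> to at most \<open>e\<close>.\<close>
    have "(\<lambda>\<omega>. e / B * (X \<omega> - B / e * snd S \<omega>)) \<in> A" using B(1) e by (intro cone *[rule_format]) simp_all
    then show "(\<lambda>\<omega>. - snd S \<omega> + e * ?I \<omega>) \<in> A"
    proof (rule acceptance_setD[OF A _ bmfun_linear[OF nT I]])
      show "e / B * (X \<omega> - B / e * snd S \<omega>) \<le> - snd S \<omega> + e * ?I \<omega>" if "\<omega> \<in> space M" for \<omega>
      proof -
        have "e / B * X \<omega> \<le> e / B * B" using B(2)[OF that] B(1) e by (intro mult_left_mono) auto
        then show ?thesis using B(1) e that by (simp add: right_diff_distrib)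
      qed
    qed
  next
    assume *: "\<forall>e>0. (\<lambda>\<omega>. - snd S \<omega> + e * ?I \<omega>) \<in> A"
    \<comment> \<open>The constant 1 is the position of risk -\<infinity>: scale the hypothesis for
      \<open>e = 1 / c\<close> by \<open>c\<close>.\<close>
    have "(\<lambda>\<omega>. ?I \<omega> - c * snd S \<omega>) \<in> A" if c: "c > 0" for c
    proof -
      have "(\<lambda>\<omega>. c * (- snd S \<omega> + 1 / c * ?I \<omega>)) \<in> A"
        using c by (intro cone *[rule_format]) simp_all
      then show ?thesis using c by (simp add: right_diff_distrib)
    qed
    then show "\<exists>X\<in>bmfun M. \<forall>c>0. (\<lambda>\<omega>. X \<omega> - c * snd S \<omega>) \<in> A" using I by blast
  qed
  then have "(\<exists>X\<in>bmfun M. risk_measure A S X = -\<infinity>) \<longleftrightarrow>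
    (\<lambda>\<omega>. - snd S \<omega>) \<in> norm_topology M closure_of A"
    using risk_measure_eq_MInf_iff[OF A S] by (simp add: closure_of_acceptance_set[OF ne A nT])
  then have "(\<forall>X\<in>bmfun M. risk_measure A S X > -\<infinity>) \<longleftrightarrow>
    (\<lambda>\<omega>. - snd S \<omega>) \<notin> norm_topology M closure_of A"
    by auto
  with i show ?thesis by blast
qed

end
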